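(* Fix a target accuracy $\epsilon>0$ and a probability of failure $p\in(0,1)$, and set $$T=\left\lceil \log_{\nu}\left(\max\left(\frac{L_{xy}^2/\mu_y+L_x}{\mu_x},\frac{L_{xy}^2/\mu_x+L_y}{\mu_y}\right)\right)\right\rceil,\quad \delta=\frac{\epsilon}{4+4T},\quad \lambda_x^i=\mu_x\nu^i,\ \ \lambda_y^i=\mu_y\nu^i\ \ \text{with } \nu=2\ \ (0\le i\le T).$$ Then the total number of samples used by $\text{BoostSAA}(\delta,p,T)$, namely $m\left(\sum_{i=0}^{T}(n_x^{i-1}+n_y^{i-1})+n_x^T+n_y^T\right)$, is bounded by $$\mathcal O\left(\ln(\kappa)\,\ln\left(\frac{\ln(\kappa)}{p}\right)\frac{C\kappa^2}{\mu\epsilon}\right).$$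
   Context: $\|\cdot\|$ is the Euclidean norm. Unconstrained stochastic saddle point problem $\min_{x\in\mathcal X}\max_{y\in\mathcal Y}\Phi(x,y):=\mathbb E[\Phi_\xi(x,y)]$ with $\mathcal X=\mathbb R^{d_x}$, $\mathcal Y=\mathbb R^{d_y}$, $\xi\sim\mathcal P$, and saddle point $(x^*,y^* )$. Assumption (SC-SC): there are $\mu_x,\mu_y>0$ such that for almost every $\xi$, $\Phi_\xi(\cdot,y)$ is $\mu_x$-strongly convex for every $y$ and $\Phi_\xi(x,\cdot)$ is $\mu_y$-strongly concave for every $x$. Assumption (smoothness): there are $L_x,L_y,L_{xy}>0$ such that for all $x_1,x_2\in\mathcal X$, $y_1,y_2\in\mathcal Y$: $\|\nabla_x \Phi(x_1,y_1)-\nabla_x\Phi(x_2,y_1)\|\le L_x\|x_1-x_2\|$, $\|\nabla_y \Phi(x_1,y_1)-\nabla_y\Phi(x_1,y_2)\|\le L_y\|y_1-y_2\|$, $\|\nabla_x \Phi(x_1,y_1)-\nabla_x\Phi(x_1,y_2)\|\le L_{xy}\|y_1-y_2\|$, $\|\nabla_y \Phi(x_1,y_1)-\nabla_y\Phi(x_2,y_1)\|\le L_{xy}\|x_1-x_2\|$. Assumption (gradient at the saddle point): there is a constant $C$ with $\mathbb E_\xi[\|\nabla\Phi_\xi(x^*,y^* )\|^2]\le C<+\infty$. $\mu:=\min\{\mu_x,\mu_y\}$, $L:=\max\{L_x,L_y,L_{xy}\}$, $\kappa:=L/\mu$. Sample average approximation (SAA): SAA$(n,\lambda_x,\lambda_y,x^c,y^c)$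 draws $n$ i.i.d. samples $\xi_1,\dots,\xi_n\sim\mathcal P$ and returns the saddle point of $\min_x\max_y\frac1n\sum_{j=1}^n\Phi_{\xi_j}(x,y)+\frac{\lambda_x}{2}\|x-x^c\|^2-\frac{\lambda_y}{2}\|y-y^c\|^2$ (a center is irrelevant when its coefficient is $0$). RobustSAA$(n,m,\lambda_x,\lambda_y,x^c,y^c)$ calls SAA$(n,\lambda_x,\lambda_y,x^c,y^c)$ $m$ times and selects one of the $m$ $x$-components and one of the $m$ $y$-components by robust distance estimation (for each candidate compute the smallest radius of a ball around it containing more than $m/2$ of the candidates, and pick any candidate whose radius is at most the median radius); it thus uses $mn$ samples. BoostSAA$(\delta,p,T)$: set $\lambda_x^{-1}=\lambda_y^{-1}=0$ and $m=\lceil 18\ln(\frac{2T+4}{p})\rceil$. For $i=0,\dots,T$ let $x_i^c$ be the $x$-output of RobustSAA$(n_x^{i-1},m,\lambda_x^{i-1},0,x_{i-1}^c,\text{none})$ and $y_i^c$ the $y$-output of RobustSAA$(n_y^{i-1},m,0,\lambda_y^{i-1},\text{none},y_{i-1}^c)$, with $$n_x^{i-1}=\left\lceil\frac{432CL_{xy}^2}{(\mu_x+\lambda_x^{i-1})\mu_y^2\delta}\right\rceil,\quad n_y^{i-1}=\left\lceil\frac{432CL_{xy}^2}{\mu_x^2(\mu_y+\lambda_y^{i-1})\delta}\right\rceil.$$ Finally return the $x$-output $x_{T+1}^c$ of RobustSAA$(n_x^{T},m,\lambda_x^{T},0,x_{T}^c,\text{none})$ and the $y$-output $y_{T+1}^c$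 of RobustSAA$(n_y^{T},m,0,\lambda_y^{T},\text{none},y_{T}^c)$, with $$n_x^T=\left\lceil \frac{L_{xy}^2/\mu_y+L_x+\lambda_x^{T}}{\mu_x+\lambda_x^{T}}\cdot\frac{432CL_{xy}^2}{(\mu_x+\lambda_x^{T})\mu_y^2\delta}\right\rceil,\quad n_y^T=\left\lceil\frac{L_{xy}^2/\mu_x+L_y+\lambda_y^{T}}{\mu_y+\lambda_y^{T}}\cdot\frac{432CL_{xy}^2}{\mu_x^2(\mu_y+\lambda_y^{T})\delta}\right\rceil.$$
   Formalization: The O-bound is proved for every c>0 with a constant depending only on c, whenever ln κ, ln(ln κ/p) and Cκ²/(με) are all at least c; without such a restriction it fails, e.g. when κ=1, when ln κ ≤ p, or as ε→∞. *)

theory Defs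
  imports "HOL-Probability.Probability" "Jordan_Normal_Form.Matrix"
begin

(* The dimensions are bound inside the theorem, so that the constant hidden in the O-notation
   is chosen before them; hence vectors of R^d are elements of "carrier_vec d". *)

type_synonym rvec = "real Matrix.vec"

definition vnorm :: "rvec \<Rightarrow> real" where
  "vnorm x = sqrt (scalar_prod x x)"

(* Frechet gradient on R^d *)
definition has_gradient :: "nat \<Rightarrow> (rvec \<Rightarrow> real) \<Rightarrow> rvec \<Rightarrow> rvec \<Rightarrow> bool" where
  "has_gradient d f g x \<longleftrightarrow>
     g \<in> carrier_vec d \<and>
     (\<forall>e>0. \<exists>r>0. \<forall>h\<in>carrier_vec d. vnorm h < r \<longrightarrow>
        \<bar>f (x + h) - f x - scalar_prod g h\<bar> \<le> e * vnorm h)"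

definition grad :: "nat \<Rightarrow> (rvec \<Rightarrow> real) \<Rightarrow> rvec \<Rightarrow> rvec" where
  "grad d f x = (THE g. has_gradient d f g x)"

definition strongly_convex :: "nat \<Rightarrow> real \<Rightarrow> (rvec \<Rightarrow> real) \<Rightarrow> bool" where
  "strongly_convex d \<mu> f \<longleftrightarrow>
     (\<forall>u\<in>carrier_vec d. \<forall>v\<in>carrier_vec d. \<forall>t\<in>{0..1}.
        f (t \<cdot>\<^sub>v u + (1 - t) \<cdot>\<^sub>v v)
          \<le> t * f u + (1 - t) * f v - \<mu> / 2 * t * (1 - t) * (vnorm (u - v))\<^sup>2)"

definition strongly_concave :: "nat \<Rightarrow> real \<Rightarrow> (rvec \<Rightarrow> real) \<Rightarrow> bool" where
  "strongly_concave d \<mu> f \<longleftrightarrow> strongly_convex d \<mu> (\<lambda>u. - f u)"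

(* F viewed as a function of the concatenated vector z = (x, y) in R^(dx + dy) *)
definition joint :: "nat \<Rightarrow> nat \<Rightarrow> (rvec \<Rightarrow> rvec \<Rightarrow> real) \<Rightarrow> rvec \<Rightarrow> real" where
  "joint dx dy F z = F (vec_first z dx) (vec_last z dy)"

locale stochastic_saddle_point_problem = prob_space M
  for M :: "'w measure" +
  fixes dx dy :: nat
    and \<phi> :: "'w \<Rightarrow> rvec \<Rightarrow> rvec \<Rightarrow> real"
    and \<Phi> :: "rvec \<Rightarrow> rvec \<Rightarrow> real"
    and xs ys :: rvec
    and \<mu>x \<mu>y Lx Ly Lxy C :: real
  assumes dims: "dx > 0" "dy > 0"
    and integrable_sample:
      "\<And>x y. x \<in> carrier_vec dx \<Longrightarrow> y \<in> carrier_vec dy \<Longrightarrow> integrable M (\<lambda>\<xi>. \<phi> \<xi> x y)"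
    and objective:
      "\<And>x y. x \<in> carrier_vec dx \<Longrightarrow> y \<in> carrier_vec dy \<Longrightarrow> \<Phi> x y = expectation (\<lambda>\<xi>. \<phi> \<xi> x y)"
    and saddle_point_carrier: "xs \<in> carrier_vec dx" "ys \<in> carrier_vec dy"
    and saddle_point:
      "\<And>y. y \<in> carrier_vec dy \<Longrightarrow> \<Phi> xs y \<le> \<Phi> xs ys"
      "\<And>x. x \<in> carrier_vec dx \<Longrightarrow> \<Phi> xs ys \<le> \<Phi> x ys"
    and moduli_pos: "\<mu>x > 0" "\<mu>y > 0"
    and sc_sc:
      "AE \<xi> in M. (\<forall>y\<in>carrier_vec dy. strongly_convex dx \<mu>x (\<lambda>x. \<phi> \<xi> x y)) \<and>
                  (\<forall>x\<in>carrier_vec dx. strongly_concave dy \<mu>y (\<lambda>y. \<phi> \<xi> x y))"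
    and smoothness_pos: "Lx > 0" "Ly > 0" "Lxy > 0"
    and differentiable:
      "\<And>x y. x \<in> carrier_vec dx \<Longrightarrow> y \<in> carrier_vec dy \<Longrightarrow> \<exists>g. has_gradient dx (\<lambda>u. \<Phi> u y) g x"
      "\<And>x y. x \<in> carrier_vec dx \<Longrightarrow> y \<in> carrier_vec dy \<Longrightarrow> \<exists>g. has_gradient dy (\<Phi> x) g y"
    and smooth_xx:
      "\<And>x1 x2 y. x1 \<in> carrier_vec dx \<Longrightarrow> x2 \<in> carrier_vec dx \<Longrightarrow> y \<in> carrier_vec dy \<Longrightarrow>
         vnorm (grad dx (\<lambda>u. \<Phi> u y) x1 - grad dx (\<lambda>u. \<Phi> u y) x2) \<le> Lx * vnorm (x1 - x2)"
    and smooth_yy: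
      "\<And>x y1 y2. x \<in> carrier_vec dx \<Longrightarrow> y1 \<in> carrier_vec dy \<Longrightarrow> y2 \<in> carrier_vec dy \<Longrightarrow>
         vnorm (grad dy (\<Phi> x) y1 - grad dy (\<Phi> x) y2) \<le> Ly * vnorm (y1 - y2)"
    and smooth_xy:
      "\<And>x y1 y2. x \<in> carrier_vec dx \<Longrightarrow> y1 \<in> carrier_vec dy \<Longrightarrow> y2 \<in> carrier_vec dy \<Longrightarrow>
         vnorm (grad dx (\<lambda>u. \<Phi> u y1) x - grad dx (\<lambda>u. \<Phi> u y2) x) \<le> Lxy * vnorm (y1 - y2)"
    and smooth_yx:
      "\<And>x1 x2 y. x1 \<in> carrier_vec dx \<Longrightarrow> x2 \<in> carrier_vec dx \<Longrightarrow> y \<in> carrier_vec dy \<Longrightarrow>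
         vnorm (grad dy (\<Phi> x1) y - grad dy (\<Phi> x2) y) \<le> Lxy * vnorm (x1 - x2)"
    and saddle_gradient_exists:
      "AE \<xi> in M. \<exists>g. has_gradient (dx + dy) (joint dx dy (\<phi> \<xi>)) g (xs @\<^sub>v ys)"
    and saddle_gradient_integrable:
      "integrable M (\<lambda>\<xi>. (vnorm (grad (dx + dy) (joint dx dy (\<phi> \<xi>)) (xs @\<^sub>v ys)))\<^sup>2)"
    and saddle_gradient_bound:
      "expectation (\<lambda>\<xi>. (vnorm (grad (dx + dy) (joint dx dy (\<phi> \<xi>)) (xs @\<^sub>v ys)))\<^sup>2) \<le> C"

definition saa_samples :: "nat \<Rightarrow> nat" where
  "saa_samples n = n"

definition robust_saa_samples :: "nat \<Rightarrow> nat \<Rightarrow> nat" where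
  "robust_saa_samples n m = m * saa_samples n"

(* r is a schedule of regularization coefficients; its entry with index -1 is 0 by convention, and
   "prev_coeff r i" is the entry with index i - 1. *)
definition prev_coeff :: "(nat \<Rightarrow> real) \<Rightarrow> nat \<Rightarrow> real" where
  "prev_coeff r i = (case i of 0 \<Rightarrow> 0 | Suc j \<Rightarrow> r j)"

(* In the two sample sizes below, \<mu>1, L1 and the coefficient r belong to the regularized variable and \<mu>2 to the
   other one: the x-sizes have (\<mu>1, \<mu>2, L1) = (\<mu>x, \<mu>y, Lx), the y-sizes (\<mu>y, \<mu>x, Ly). *)
definition stage_size :: "real \<Rightarrow> real \<Rightarrow> real \<Rightarrow> real \<Rightarrow> real \<Rightarrow> real \<Rightarrow> nat" where
  "stage_size C Lxy \<mu>1 \<mu>2 \<delta> r =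
     nat \<lceil>432 * C * Lxy\<^sup>2 / ((\<mu>1 + r) * \<mu>2\<^sup>2 * \<delta>)\<rceil>"

definition final_size :: "real \<Rightarrow> real \<Rightarrow> real \<Rightarrow> real \<Rightarrow> real \<Rightarrow> real \<Rightarrow> real \<Rightarrow> nat" where
  "final_size C Lxy \<mu>1 \<mu>2 L1 \<delta> r =
     nat \<lceil>(Lxy\<^sup>2 / \<mu>2 + L1 + r) / (\<mu>1 + r) *
          (432 * C * Lxy\<^sup>2 / ((\<mu>1 + r) * \<mu>2\<^sup>2 * \<delta>))\<rceil>"

definition boost_trials :: "real \<Rightarrow> nat \<Rightarrow> nat" where
  "boost_trials p T = nat \<lceil>18 * ln ((2 * real T + 4) / p)\<rceil>"

definition boost_saa_samples ::
  "real \<Rightarrow> real \<Rightarrow> real \<Rightarrow> real \<Rightarrow> real \<Rightarrow> real \<Rightarrow> (nat \<Rightarrow> real) \<Rightarrow> (nat \<Rightarrow> real) \<Rightarrow>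
   real \<Rightarrow> real \<Rightarrow> nat \<Rightarrow> nat" where
  "boost_saa_samples \<mu>x \<mu>y Lx Ly Lxy C rx ry \<delta> p T =
     (let m = boost_trials p T in
        (\<Sum>i=0..T. robust_saa_samples (stage_size C Lxy \<mu>x \<mu>y \<delta> (prev_coeff rx i)) m
                 + robust_saa_samples (stage_size C Lxy \<mu>y \<mu>x \<delta> (prev_coeff ry i)) m)
        + robust_saa_samples (final_size C Lxy \<mu>x \<mu>y Lx \<delta> (rx T)) m
        + robust_saa_samples (final_size C Lxy \<mu>y \<mu>x Ly \<delta> (ry T)) m)"

end

(* Each sample size is at most a constant times (1 + T) * C \<kappa>^2 / (\<mu> \<epsilon>), up to the ceiling.  The factor
   1 + T comes only from 1/\<delta>: the stage sizes carry weights 1/(1 + 2^(i-1)), which sum to at most 3,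
   and T is exactly large enough for the conditioning factor of the final stage to be at most 2.
   Finally T = O(ln \<kappa>) and m = O(ln (T/p)). *)
theory Submission
  imports Defs
begin

lemma nat_ceiling_le_add_one:
  fixes x y :: real
  assumes "x \<le> y" "0 \<le> y"
  shows "real (nat \<lceil>x\<rceil>) \<le> y + 1"
  using assms by linarith

text \<open>The first weight is 1, since the coefficient of index -1 is 0; the later ones are
  dominated by a geometric series. Subtracting \<open>2 / 2 ^ n\<close> makes the induction close:
  it drops by exactly \<open>1 / 2 ^ n\<close> at each step.\<close>

lemma sum_prev_coeff_weights:
  "(\<Sum>i=0..n. 1 / (1 + prev_coeff (\<lambda>i. 2 ^ i) i)) \<le> 3 - 2 / 2 ^ n"
proof (induction n)
  case 0
  then show ?case by (simp add: prev_coeff_def)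
next
  case (Suc n)
  have "1 / (1 + 2 ^ n) \<le> (1 / 2 ^ n :: real)"
    by (intro divide_left_mono mult_pos_pos add_pos_pos) auto
  then show ?case using Suc by (simp add: prev_coeff_def)
qed

lemma prev_coeff_scale: "prev_coeff (\<lambda>i. a * f i) i = a * prev_coeff f i"
  by (simp add: prev_coeff_def split: nat.split)

lemma prev_coeff_nonneg: "(\<And>i. 0 \<le> f i) \<Longrightarrow> 0 \<le> prev_coeff f i"
  by (simp add: prev_coeff_def split: nat.split)

text \<open>Measuring the coefficient as a multiple \<open>q\<close> of \<mu>1 makes the regularized
  modulus factor as \<open>\<mu>1 * (1 + q)\<close>. Replacing the moduli by \<mu> and
  \<open>Lxy\<close> by \<open>L\<close> then leaves a common rate times the weight
  \<open>1 / (1 + q)\<close>.\<close>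

lemma sample_rate_le:
  fixes C Lxy \<mu> \<mu>1 \<mu>2 \<delta> q L :: real
  assumes "0 < \<mu>" "\<mu> \<le> \<mu>1" "\<mu> \<le> \<mu>2" "0 \<le> Lxy" "Lxy \<le> L" "0 < C" "0 < \<delta>" "0 \<le> q"
  shows "432 * C * Lxy\<^sup>2 / ((\<mu>1 + \<mu>1 * q) * \<mu>2\<^sup>2 * \<delta>)
           \<le> 432 * (C * (L / \<mu>)\<^sup>2 / (\<mu> * \<delta>)) * (1 / (1 + q))"
proof -
  have den: "(\<mu> * (1 + q)) * \<mu>\<^sup>2 * \<delta> \<le> (\<mu>1 * (1 + q)) * \<mu>2\<^sup>2 * \<delta>"
    using assms by (intro mult_mono power_mono) auto
  have "Lxy\<^sup>2 \<le> L\<^sup>2"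
    using assms by (intro power_mono) auto
  then have "432 * C * Lxy\<^sup>2 / ((\<mu>1 * (1 + q)) * \<mu>2\<^sup>2 * \<delta>)
      \<le> 432 * C * L\<^sup>2 / ((\<mu> * (1 + q)) * \<mu>\<^sup>2 * \<delta>)"
    using assms by (intro frac_le den) auto
  also have "\<dots> = 432 * (C * (L / \<mu>)\<^sup>2 / (\<mu> * \<delta>)) * (1 / (1 + q))"
    by (simp add: power_divide mult_ac)
  finally show ?thesis by (simp add: distrib_left)
qed

text \<open>This is the share of one variable in a single trial; swapping the moduli gives the
  other. Here 2160 = (3 + 2) * 432: the stage weights contribute 3 and the conditioning factor of
  the final stage 2. The ceilings cost \<open>T + 2\<close>, one for each of the
  \<open>T + 1\<close> stages and one for the final stage.\<close>

lemma stage_sizes_plus_final_size_le: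
  fixes C Lxy \<mu> \<mu>1 \<mu>2 \<delta> L1 L :: real
  assumes pos: "0 < \<mu>" "\<mu> \<le> \<mu>1" "\<mu> \<le> \<mu>2" "0 \<le> Lxy" "Lxy \<le> L" "0 < C" "0 < \<delta>"
    and "0 < L1" and T: "(Lxy\<^sup>2 / \<mu>2 + L1) / \<mu>1 \<le> 2 ^ T"
  shows "(\<Sum>i=0..T. real (stage_size C Lxy \<mu>1 \<mu>2 \<delta> (prev_coeff (\<lambda>i. \<mu>1 * 2 ^ i) i)))
           + real (final_size C Lxy \<mu>1 \<mu>2 L1 \<delta> (\<mu>1 * 2 ^ T))
         \<le> 2160 * (C * (L / \<mu>)\<^sup>2 / (\<mu> * \<delta>)) + real T + 2"
proof -
  define D where "D = 432 * (C * (L / \<mu>)\<^sup>2 / (\<mu> * \<delta>))"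
  have D: "0 \<le> D" using pos by (simp add: D_def)
  have stage: "real (stage_size C Lxy \<mu>1 \<mu>2 \<delta> (prev_coeff (\<lambda>i. \<mu>1 * 2 ^ i) i))
      \<le> D * (1 / (1 + prev_coeff (\<lambda>i. 2 ^ i) i)) + 1" for i
  proof -
    have q: "0 \<le> prev_coeff (\<lambda>i. 2 ^ i) i" by (rule prev_coeff_nonneg) simp
    show ?thesis
      unfolding stage_size_def prev_coeff_scale
    proof (rule nat_ceiling_le_add_one)
      show "432 * C * Lxy\<^sup>2 / ((\<mu>1 + \<mu>1 * prev_coeff (\<lambda>i. 2 ^ i) i) * \<mu>2\<^sup>2 * \<delta>)
          \<le> D * (1 / (1 + prev_coeff (\<lambda>i. 2 ^ i) i))"
        unfolding D_def by (rule sample_rate_le[OF pos q])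
      show "0 \<le> D * (1 / (1 + prev_coeff (\<lambda>i. 2 ^ i) i))"
        using D q by (intro mult_nonneg_nonneg) auto
    qed
  qed
  have "(\<Sum>i=0..T. real (stage_size C Lxy \<mu>1 \<mu>2 \<delta> (prev_coeff (\<lambda>i. \<mu>1 * 2 ^ i) i)))
      \<le> (\<Sum>i=0..T. D * (1 / (1 + prev_coeff (\<lambda>i. 2 ^ i) i)) + 1)"
    by (intro sum_mono stage)
  also have "\<dots> = D * (\<Sum>i=0..T. 1 / (1 + prev_coeff (\<lambda>i. 2 ^ i) i)) + (real T + 1)"
    unfolding sum.distrib sum_distrib_left by simp
  also have "\<dots> \<le> D * 3 + (real T + 1)"
  proof -
    have "(\<Sum>i=0..T. 1 / (1 + prev_coeff (\<lambda>i. 2 ^ i) i)) \<le> (3 :: real)"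
      by (rule order_trans[OF sum_prev_coeff_weights]) simp
    then show ?thesis using D by (intro add_right_mono mult_left_mono)
  qed
  finally have stages: "(\<Sum>i=0..T. real (stage_size C Lxy \<mu>1 \<mu>2 \<delta> (prev_coeff (\<lambda>i. \<mu>1 * 2 ^ i) i)))
      \<le> 3 * D + (real T + 1)" by simp
  have pos1: "0 < \<mu>1" "0 < \<mu>2" using pos by auto
  \<comment> \<open>The choice of \<open>T\<close> lets the last coefficient dominate the
    unregularized smoothness constant, so the numerator below is at most twice that coefficient,
    which the denominator exceeds.\<close>
  have "Lxy\<^sup>2 / \<mu>2 + L1 \<le> \<mu>1 * 2 ^ T"
    using T pos1 by (simp add: divide_le_eq mult.commute)
  then have factor: "(Lxy\<^sup>2 / \<mu>2 + L1 + \<mu>1 * 2 ^ T) / (\<mu>1 + \<mu>1 * 2 ^ T) \<le> 2"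
    using pos1 by (simp add: divide_le_eq add_pos_pos)
  have "432 * C * Lxy\<^sup>2 / ((\<mu>1 + \<mu>1 * 2 ^ T) * \<mu>2\<^sup>2 * \<delta>) \<le> D * (1 / (1 + 2 ^ T))"
    unfolding D_def by (rule sample_rate_le[OF pos]) simp
  also have "\<dots> \<le> D * 1"
    using D by (intro mult_left_mono) (auto simp: divide_le_eq add_pos_pos)
  finally have "(Lxy\<^sup>2 / \<mu>2 + L1 + \<mu>1 * 2 ^ T) / (\<mu>1 + \<mu>1 * 2 ^ T) *
      (432 * C * Lxy\<^sup>2 / ((\<mu>1 + \<mu>1 * 2 ^ T) * \<mu>2\<^sup>2 * \<delta>)) \<le> 2 * D"
    using factor pos pos1 by (intro mult_mono) auto
  then have "real (final_size C Lxy \<mu>1 \<mu>2 L1 \<delta> (\<mu>1 * 2 ^ T)) \<le> 2 * D + 1"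
    unfolding final_size_def using D by (intro nat_ceiling_le_add_one) auto
  with stages have "(\<Sum>i=0..T. real (stage_size C Lxy \<mu>1 \<mu>2 \<delta> (prev_coeff (\<lambda>i. \<mu>1 * 2 ^ i) i)))
      + real (final_size C Lxy \<mu>1 \<mu>2 L1 \<delta> (\<mu>1 * 2 ^ T)) \<le> (3 * D + (real T + 1)) + (2 * D + 1)"
    by (rule add_mono)
  also have "\<dots> = 2160 * (C * (L / \<mu>)\<^sup>2 / (\<mu> * \<delta>)) + real T + 2" by (simp add: D_def)
  finally show ?thesis .
qed

text \<open>Truncation by \<open>nat\<close> only raises a negative exponent to 0, so the bound
  survives for \<open>y\<close> below 1. Keeping \<open>x\<close> apart from \<open>y\<close> lets
  one \<open>T\<close>, defined by a maximum, serve both variables.\<close>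

lemma le_two_power_nat_ceiling_log:
  fixes x y :: real
  assumes "0 < x" "x \<le> y"
  shows "x \<le> 2 ^ nat \<lceil>log 2 y\<rceil>"
proof -
  have "log 2 y \<le> real (nat \<lceil>log 2 y\<rceil>)" by linarith
  then have "y \<le> 2 powr real (nat \<lceil>log 2 y\<rceil>)"
    using assms by (subst (asm) log_le_iff) auto
  then show ?thesis using assms by (simp add: powr_realpow)
qed

text \<open>Since \<mu> \<le> \<open>L\<close>, the linear term \<open>L1\<close> is also at most
  \<open>L\<^sup>2 / \<mu>\<close>, so the two summands together cost only a factor 2.\<close>

lemma condition_ratio_le:
  fixes \<mu> \<mu>1 \<mu>2 Lxy L1 L :: real
  assumes "0 < \<mu>" "\<mu> \<le> \<mu>1" "\<mu> \<le> \<mu>2" "0 \<le> Lxy" "Lxy \<le> L" "0 \<le> L1" "L1 \<le> L" "\<mu> \<le> L"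
  shows "(Lxy\<^sup>2 / \<mu>2 + L1) / \<mu>1 \<le> 2 * (L / \<mu>)\<^sup>2"
proof -
  have "Lxy\<^sup>2 / \<mu>2 \<le> L\<^sup>2 / \<mu>"
    using assms by (intro frac_le power_mono) auto
  moreover have "L1 \<le> L\<^sup>2 / \<mu>"
  proof -
    have "L1 * \<mu> \<le> L * L" using assms by (intro mult_mono) auto
    then show ?thesis using assms by (simp add: le_divide_eq power2_eq_square)
  qed
  ultimately have "(Lxy\<^sup>2 / \<mu>2 + L1) / \<mu>1 \<le> (2 * (L\<^sup>2 / \<mu>)) / \<mu>"
    using assms by (intro frac_le) auto
  also have "\<dots> = 2 * (L / \<mu>)\<^sup>2" by (simp add: power2_eq_square)
  finally show ?thesis .
qed

text \<open>The inequality 2 \<le> 3 * \<open>ln 2\<close> converts two binary logarithms into three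
  natural ones. One unit of the additive 2 comes from the factor 2 before the square, the other from
  the ceiling.\<close>

lemma nat_ceiling_log_le:
  fixes y \<kappa> :: real
  assumes "0 < y" "y \<le> 2 * \<kappa>\<^sup>2" "1 \<le> \<kappa>"
  shows "real (nat \<lceil>log 2 y\<rceil>) \<le> 3 * ln \<kappa> + 2"
proof -
  have "ln y \<le> ln (2 * \<kappa>\<^sup>2)" using assms by simp
  also have "\<dots> = ln 2 + 2 * ln \<kappa>" using assms by (simp add: ln_mult ln_realpow)
  also have "\<dots> \<le> ln 2 + (3 * ln \<kappa>) * ln 2"
    using mult_left_mono[OF ln2_ge_two_thirds, of "3 * ln \<kappa>"] assms by simp
  also have "\<dots> = (3 * ln \<kappa> + 1) * ln 2" by (simp add: algebra_simps)
  finally have "log 2 y \<le> 3 * ln \<kappa> + 1" by (simp add: log_def divide_le_eq)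
  moreover have "0 \<le> 3 * ln \<kappa> + 1" using assms by simp
  ultimately have "real (nat \<lceil>log 2 y\<rceil>) \<le> (3 * ln \<kappa> + 1) + 1"
    by (rule nat_ceiling_le_add_one)
  then show ?thesis by simp
qed

text \<open>From 2T + 4 \<le> 4(T + 1) the logarithm splits into \<open>ln (4 * a)\<close> and
  \<open>ln (l / p)\<close>. As the latter is at least \<open>c\<close>, the constant
  \<open>ln (4 * a)\<close> and the 1 from the ceiling become multiples of it. The role of
  \<open>l\<close> is that of \<open>ln \<kappa>\<close>.\<close>

lemma boost_trials_le:
  fixes c a l p :: real
  assumes "0 < c" "1 \<le> 4 * a" "real T + 1 \<le> a * l" "0 < l" "0 < p" "c \<le> ln (l / p)"
  shows "real (boost_trials p T) \<le> (18 * (ln (4 * a) / c + 1) + 1 / c) * ln (l / p)"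
proof -
  define B where "B = ln (l / p)"
  have B: "1 \<le> B / c" "0 \<le> B"
    using assms unfolding B_def by (simp_all only: le_divide_eq) auto
  have "(2 * real T + 4) / p \<le> (4 * a) * (l / p)"
    using assms by (simp add: divide_right_mono)
  then have "ln ((2 * real T + 4) / p) \<le> ln ((4 * a) * (l / p))"
    using assms by (subst ln_le_cancel_iff) auto
  also have "\<dots> = ln (4 * a) + B"
    using assms by (subst ln_mult) (auto simp: B_def)
  also have "\<dots> \<le> ln (4 * a) * (B / c) + B"
    using mult_left_mono[OF B(1), of "ln (4 * a)"] assms by simp
  finally have "18 * ln ((2 * real T + 4) / p) \<le> 18 * (ln (4 * a) * (B / c) + B)" by simp
  moreover have "0 \<le> 18 * (ln (4 * a) * (B / c) + B)"
    using assms by (intro mult_nonneg_nonneg add_nonneg_nonneg divide_nonneg_nonneg B) auto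
  ultimately have "real (boost_trials p T) \<le> 18 * (ln (4 * a) * (B / c) + B) + 1"
    unfolding boost_trials_def by (rule nat_ceiling_le_add_one)
  also have "\<dots> \<le> 18 * (ln (4 * a) * (B / c) + B) + B / c" using B(1) by simp
  also have "\<dots> = (18 * (ln (4 * a) / c + 1) + 1 / c) * B" by (simp add: algebra_simps)
  finally show ?thesis by (simp add: B_def)
qed

text \<open>The constant is a product of three: the number of trials relative to
  \<open>ln (ln \<kappa> / p)\<close>, \<open>T + 1\<close> relative to \<open>ln \<kappa>\<close>,
  and the samples per trial relative to \<open>(T + 1) * A\<close>. Each term in
  \<open>1 / c\<close> arises by absorbing an additive constant.\<close>

lemma boost_saa_samples_le:
  fixes c \<mu>x \<mu>y Lx Ly Lxy C \<epsilon> p :: real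
  defines "\<mu> \<equiv> min \<mu>x \<mu>y"
  defines "L \<equiv> max Lx (max Ly Lxy)"
  defines "\<kappa> \<equiv> L / \<mu>"
  defines "T \<equiv> nat \<lceil>log 2 (max ((Lxy\<^sup>2 / \<mu>y + Lx) / \<mu>x) ((Lxy\<^sup>2 / \<mu>x + Ly) / \<mu>y))\<rceil>"
  defines "A \<equiv> C * \<kappa>\<^sup>2 / (\<mu> * \<epsilon>)"
  assumes pos: "0 < \<mu>x" "0 < \<mu>y" "0 < Lx" "0 < Ly" "0 < Lxy" "0 < \<epsilon>" "0 < p" "0 < c"
    and regime: "c \<le> ln \<kappa>" "c \<le> ln (ln \<kappa> / p)" "c \<le> A"
  shows "real (boost_saa_samples \<mu>x \<mu>y Lx Ly Lxy C (\<lambda>i. \<mu>x * 2 ^ i) (\<lambda>i. \<mu>y * 2 ^ i)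
             (\<epsilon> / (4 + 4 * real T)) p T)
         \<le> ((18 * (ln (4 * (3 + 3 / c)) / c + 1) + 1 / c) * (3 + 3 / c) * (17280 + 4 / c))
             * (ln \<kappa> * ln (ln \<kappa> / p) * A)"
proof -
  define \<delta> where "\<delta> = \<epsilon> / (4 + 4 * real T)"
  define y where "y = max ((Lxy\<^sup>2 / \<mu>y + Lx) / \<mu>x) ((Lxy\<^sup>2 / \<mu>x + Ly) / \<mu>y)"
  have \<mu>: "0 < \<mu>" "\<mu> \<le> \<mu>x" "\<mu> \<le> \<mu>y" using pos by (auto simp: \<mu>_def)
  have L: "Lx \<le> L" "Ly \<le> L" "Lxy \<le> L" "0 < L" using pos by (auto simp: L_def)
  have "0 < \<kappa>" using \<mu> L by (simp add: \<kappa>_def)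
  then have \<kappa>: "1 < \<kappa>" using regime(1) pos by (metis ln_gt_zero_iff less_le_trans)
  then have \<mu>L: "\<mu> \<le> L" using \<mu> by (simp add: \<kappa>_def)
  have \<delta>: "0 < \<delta>" using pos by (simp add: \<delta>_def add_pos_nonneg)
  have Apos: "0 < A" using regime pos by simp
  \<comment> \<open>The sign of \<open>C\<close> is read off from \<open>A\<close>, whose other
    factors are positive.\<close>
  have "0 < C"
    using Apos \<mu> pos \<kappa> unfolding A_def
    by (metis less_le_trans less_numeral_extra(1) mult_pos_pos not_less order.asym
        zero_less_divide_iff zero_less_mult_pos2 zero_less_power)
  have hx: "0 < (Lxy\<^sup>2 / \<mu>y + Lx) / \<mu>x" "(Lxy\<^sup>2 / \<mu>y + Lx) / \<mu>x \<le> y"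
    and hy: "0 < (Lxy\<^sup>2 / \<mu>x + Ly) / \<mu>y" "(Lxy\<^sup>2 / \<mu>x + Ly) / \<mu>y \<le> y"
    using pos by (auto simp: y_def intro!: divide_pos_pos add_nonneg_pos)
  have "y \<le> 2 * \<kappa>\<^sup>2"
    using condition_ratio_le[OF \<mu>(1) \<mu>(2) \<mu>(3), of Lxy L Lx]
      condition_ratio_le[OF \<mu>(1) \<mu>(3) \<mu>(2), of Lxy L Ly] L \<mu>L pos
    by (simp add: y_def \<kappa>_def)
  then have "real T \<le> 3 * ln \<kappa> + 2"
    using nat_ceiling_log_le[of y \<kappa>] hx \<kappa> by (simp add: T_def y_def[symmetric])
  moreover have "3 \<le> 3 / c * ln \<kappa>"
    using regime pos by (simp add: le_divide_eq)
  ultimately have T: "real T + 1 \<le> (3 + 3 / c) * ln \<kappa>"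
    by (simp add: algebra_simps)
  have sizes: "(\<Sum>i=0..T. real (stage_size C Lxy \<mu>1 \<mu>2 \<delta> (prev_coeff (\<lambda>i. \<mu>1 * 2 ^ i) i)))
           + real (final_size C Lxy \<mu>1 \<mu>2 L1 \<delta> (\<mu>1 * 2 ^ T))
         \<le> (8640 + 2 / c) * ((real T + 1) * A)"
    if "\<mu> \<le> \<mu>1" "\<mu> \<le> \<mu>2" "0 < L1" "(Lxy\<^sup>2 / \<mu>2 + L1) / \<mu>1 \<le> 2 ^ T" for \<mu>1 \<mu>2 L1
  proof -
    \<comment> \<open>The factor 4(T + 1) is \<epsilon> / \<delta>; it turns 2160 into 8640.\<close>
    have "C * (L / \<mu>)\<^sup>2 / (\<mu> * \<delta>) = 4 * ((real T + 1) * A)"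
      by (simp add: \<delta>_def A_def \<kappa>_def algebra_simps)
    \<comment> \<open>The cost of the ceilings is absorbed through T + 2 \<le> 2(T + 1) and 1 \<le>
      \<open>A / c\<close>.\<close>
    moreover have "real T + 2 \<le> 2 / c * ((real T + 1) * A)"
    proof -
      have "1 \<le> A / c" using regime pos by simp
      then have "(2 * (real T + 1)) * 1 \<le> (2 * (real T + 1)) * (A / c)"
        by (intro mult_left_mono) auto
      then show ?thesis by (simp add: mult_ac)
    qed
    ultimately show ?thesis
      using stage_sizes_plus_final_size_le[OF \<mu>(1) that(1,2) _ L(3) \<open>0 < C\<close> \<delta> that(3,4)] pos
      by (simp add: algebra_simps)
  qed
  define m where "m = real (boost_trials p T)"
  have m: "m \<le> (18 * (ln (4 * (3 + 3 / c)) / c + 1) + 1 / c) * ln (ln \<kappa> / p)"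
    unfolding m_def using T \<kappa> pos regime by (intro boost_trials_le) auto
  have "real (boost_saa_samples \<mu>x \<mu>y Lx Ly Lxy C (\<lambda>i. \<mu>x * 2 ^ i) (\<lambda>i. \<mu>y * 2 ^ i) \<delta> p T)
      = m * (((\<Sum>i=0..T. real (stage_size C Lxy \<mu>x \<mu>y \<delta> (prev_coeff (\<lambda>i. \<mu>x * 2 ^ i) i)))
                + real (final_size C Lxy \<mu>x \<mu>y Lx \<delta> (\<mu>x * 2 ^ T)))
            + ((\<Sum>i=0..T. real (stage_size C Lxy \<mu>y \<mu>x \<delta> (prev_coeff (\<lambda>i. \<mu>y * 2 ^ i) i)))
                + real (final_size C Lxy \<mu>y \<mu>x Ly \<delta> (\<mu>y * 2 ^ T))))"
    by (simp add: boost_saa_samples_def robust_saa_samples_def saa_samples_def Let_def m_def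
        sum.distrib sum_distrib_left algebra_simps)
  also have "\<dots> \<le> m * ((8640 + 2 / c) * ((real T + 1) * A) + (8640 + 2 / c) * ((real T + 1) * A))"
  proof -
    have "(Lxy\<^sup>2 / \<mu>y + Lx) / \<mu>x \<le> 2 ^ T" "(Lxy\<^sup>2 / \<mu>x + Ly) / \<mu>y \<le> 2 ^ T"
      unfolding T_def y_def[symmetric] using hx hy by (auto intro: le_two_power_nat_ceiling_log)
    then show ?thesis
      using \<mu> pos by (intro mult_left_mono add_mono sizes) (auto simp: m_def)
  qed
  also have "\<dots> = m * (real T + 1) * ((17280 + 4 / c) * A)"
    by (simp add: algebra_simps add_divide_distrib)
  also have "\<dots> \<le> ((18 * (ln (4 * (3 + 3 / c)) / c + 1) + 1 / c) * ln (ln \<kappa> / p))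
      * ((3 + 3 / c) * ln \<kappa>) * ((17280 + 4 / c) * A)"
    using m T Apos pos by (intro mult_right_mono mult_mono) (auto simp: m_def)
  finally show ?thesis by (simp add: \<delta>_def mult_ac)
qed

(* The O-bound: one constant K, independent of the problem and of all its parameters, in every
   regime in which the three factors of the rate stay above some fixed c > 0. *)
theorem mainTheorem6:
  fixes c :: real
  assumes "c > 0"
  shows "\<exists>K>0. \<forall>(M :: 'w measure) dx dy \<phi> \<Phi> xs ys \<mu>x \<mu>y Lx Ly Lxy C \<epsilon> p.
    stochastic_saddle_point_problem M dx dy \<phi> \<Phi> xs ys \<mu>x \<mu>y Lx Ly Lxy C \<longrightarrow>
    \<epsilon> > 0 \<longrightarrow> 0 < p \<longrightarrow> p < 1 \<longrightarrow>
    (let \<mu> = min \<mu>x \<mu>y;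
         L = max Lx (max Ly Lxy);
         \<kappa> = L / \<mu>;
         \<nu> = 2;
         T = nat \<lceil>log \<nu> (max ((Lxy\<^sup>2 / \<mu>y + Lx) / \<mu>x) ((Lxy\<^sup>2 / \<mu>x + Ly) / \<mu>y))\<rceil>;
         \<delta> = \<epsilon> / (4 + 4 * real T);
         rx = (\<lambda>i. \<mu>x * \<nu> ^ i);
         ry = (\<lambda>i. \<mu>y * \<nu> ^ i)
     in c \<le> ln \<kappa> \<longrightarrow> c \<le> ln (ln \<kappa> / p) \<longrightarrow> c \<le> C * \<kappa>\<^sup>2 / (\<mu> * \<epsilon>) \<longrightarrow>
        real (boost_saa_samples \<mu>x \<mu>y Lx Ly Lxy C rx ry \<delta> p T)
          \<le> K * (ln \<kappa> * ln (ln \<kappa> / p) * (C * \<kappa>\<^sup>2 / (\<mu> * \<epsilon>))))"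
proof (rule exI[of _ "(18 * (ln (4 * (3 + 3 / c)) / c + 1) + 1 / c) * (3 + 3 / c) * (17280 + 4 / c)"],
    rule conjI, goal_cases)
  case 1
  \<comment> \<open>The logarithm is the only factor of the constant whose sign is not immediate;
    its argument exceeds 1.\<close>
  have "0 \<le> ln (4 * (3 + 3 / c))" using assms by (intro ln_ge_zero) simp
  then show ?case
    using assms by (intro mult_pos_pos add_pos_pos add_nonneg_pos mult_nonneg_nonneg) auto
next
  case 2
  show ?case
  proof (intro allI impI, goal_cases)
    case (1 M dx dy \<phi> \<Phi> xs ys \<mu>x \<mu>y Lx Ly Lxy C \<epsilon> p)
    interpret stochastic_saddle_point_problem M dx dy \<phi> \<Phi> xs ys \<mu>x \<mu>y Lx Ly Lxy C
      by (fact 1(1))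
    note bound = boost_saa_samples_le[OF moduli_pos smoothness_pos 1(2,3) assms]
    show ?case
      unfolding Let_def by (intro impI) (rule bound)
  qed
qed

end
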